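(* Let $\ell,m,n$ be positive integers, let $\alpha\ge1$, $x>0$, and $\lambda_{ijk}>0$ for $1\le i\le\ell$, $1\le j\le m$, and $1\le k\le n$. Then $$\sum_{k=1}^n\sum_{j=1}^m\frac{\bigl(\sum_{i=1}^\ell\lambda_{ijk}\bigr)^{\alpha-1}}{e^{x/\sum_{i=1}^\ell\lambda_{ijk}}-1}+\sum_{i=1}^\ell\sum_{k=1}^n\frac{\bigl(\sum_{j=1}^m\lambda_{ijk}\bigr)^{\alpha-1}}{e^{x/\sum_{j=1}^m\lambda_{ijk}}-1}+\sum_{j=1}^m\sum_{i=1}^\ell\frac{\bigl(\sum_{k=1}^n\lambda_{ijk}\bigr)^{\alpha-1}}{e^{x/\sum_{k=1}^n\lambda_{ijk}}-1}\ge3\sum_{k=1}^n\sum_{j=1}^m\sum_{i=1}^\ell\frac{\lambda_{ijk}^{\alpha-1}}{e^{x/\lambda_{ijk}}-1}$$ and $$\sum_{k=1}^n\frac{\bigl(\sum_{j=1}^m\sum_{i=1}^\ell\lambda_{ijk}\bigr)^{\alpha-1}}{e^{x/\sum_{j=1}^m\sum_{i=1}^\ell\lambda_{ijk}}-1}+\sum_{i=1}^\ell\frac{\bigl(\sum_{k=1}^n\sum_{j=1}^m\lambda_{ijk}\bigr)^{\alpha-1}}{e^{x/\sum_{k=1}^n\sum_{j=1}^m\lambda_{ijk}}-1}+\sum_{j=1}^m\frac{\bigl(\sum_{i=1}^\ell\sum_{k=1}^n\lambda_{ijk}\bigr)^{\alpha-1}}{e^{x/\sum_{i=1}^\ell\sum_{k=1}^n\lambda_{ijk}}-1}\ge3\sum_{k=1}^n\sum_{j=1}^m\sum_{i=1}^\ell\frac{\lambda_{ijk}^{\alpha-1}}{e^{x/\lambda_{ijk}}-1}.$$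 *)

theory Defs
  imports Complex_Main
begin

end

theory Submission
  imports Defs
begin

text \<open>
  Put \<open>f t = t\<^sup>\<alpha>\<^sup>-\<^sup>1 / (exp (x / t) - 1)\<close>. Convexity of \<open>exp\<close> makes
  \<open>(exp u - 1) / u\<close> increasing in \<open>u\<close>, so with \<open>u = x / t\<close> and \<open>\<alpha> \<ge> 1\<close> the quotient \<open>f t / t\<close> is
  increasing in \<open>t\<close>. Hence \<open>f\<close> is superadditive on the positive reals, and each of the three
  sums on the left dominates the full triple sum.
\<close>

definition bose :: "real \<Rightarrow> real \<Rightarrow> real \<Rightarrow> real" where
  "bose \<alpha> x t = t powr (\<alpha> - 1) / (exp (x / t) - 1)"

lemma mult_exp_divide_minus_one_antimono:
  fixes s t x :: real
  assumes "0 < s" "s \<le> t"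
  shows "t * (exp (x / t) - 1) \<le> s * (exp (x / s) - 1)"
proof -
  \<comment> \<open>The tangent to \<open>exp\<close> at \<open>x / t\<close>, evaluated at \<open>x / s\<close> and at \<open>0\<close>.\<close>
  have tangent: "exp (x / t) * (1 + (v - x / t)) \<le> exp v" for v
  proof -
    have "exp (x / t) * (1 + (v - x / t)) \<le> exp (x / t) * exp (v - x / t)"
      by (intro mult_left_mono exp_ge_add_one_self) simp
    then show ?thesis by (simp flip: exp_add)
  qed
  \<comment> \<open>The tangent is affine in \<open>v\<close>, and with weights \<open>s\<close> and
    \<open>t - s\<close> the points \<open>x / s\<close> and \<open>0\<close> average to
    \<open>x / t\<close>.\<close>
  have "t * exp (x / t)
      = s * (exp (x / t) * (1 + (x / s - x / t))) + (t - s) * (exp (x / t) * (1 + (0 - x / t)))"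
    using assms by (simp add: field_simps)
  also have "\<dots> \<le> s * exp (x / s) + (t - s) * exp 0"
    using assms by (intro add_mono mult_left_mono tangent) auto
  finally show ?thesis by (simp add: algebra_simps)
qed

text \<open>Dividing by \<open>t\<close> puts the factor \<open>t\<close> into the denominator,
  which becomes \<open>t * (exp (x / t) - 1)\<close>: positive because \<open>x > 0\<close>, and
  antitone in \<open>t\<close>. The numerator grows because \<open>\<alpha> \<ge> 1\<close>.\<close>

lemma bose_divide_mono:
  assumes "\<alpha> \<ge> 1" "x > 0" "0 < s" "s \<le> t"
  shows "bose \<alpha> x s / s \<le> bose \<alpha> x t / t"
proof -
  have "s powr (\<alpha> - 1) / (s * (exp (x / s) - 1)) \<le> t powr (\<alpha> - 1) / (t * (exp (x / t) - 1))"
    using assms by (intro frac_le powr_mono2 mult_exp_divide_minus_one_antimono) auto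
  then show ?thesis by (simp add: bose_def mult.commute)
qed

lemma bose_superadditive:
  assumes "\<alpha> \<ge> 1" "x > 0" "finite I" and pos: "\<And>i. i \<in> I \<Longrightarrow> a i > 0"
  shows "(\<Sum>i\<in>I. bose \<alpha> x (a i)) \<le> bose \<alpha> x (\<Sum>i\<in>I. a i)"
proof (cases "I = {}")
  case True
  \<comment> \<open>Division by zero yields \<open>0\<close>, so
    \<open>bose \<alpha> x 0 = 0\<close>.\<close>
  then show ?thesis by (simp add: bose_def)
next
  case False
  define S where "S = (\<Sum>i\<in>I. a i)"
  have "S > 0"
    unfolding S_def using assms False by (intro sum_pos) auto
  \<comment> \<open>Each term is at most its proportional share \<open>a i / S\<close> of
    \<open>bose \<alpha> x S\<close>, and the shares add up to the whole.\<close>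
  have "bose \<alpha> x (a i) \<le> a i * (bose \<alpha> x S / S)" if "i \<in> I" for i
  proof -
    have "a i \<le> S"
      unfolding S_def using that assms by (intro member_le_sum) (auto intro: less_imp_le)
    then have "a i * (bose \<alpha> x (a i) / a i) \<le> a i * (bose \<alpha> x S / S)"
      using assms pos[OF that] by (intro mult_left_mono bose_divide_mono) auto
    then show ?thesis using pos[OF that] by simp
  qed
  then have "(\<Sum>i\<in>I. bose \<alpha> x (a i)) \<le> (\<Sum>i\<in>I. a i * (bose \<alpha> x S / S))"
    by (rule sum_mono)
  also have "\<dots> = bose \<alpha> x S"
    using \<open>S > 0\<close> by (simp only: S_def flip: sum_distrib_right) simp
  finally show ?thesis by (simp add: S_def)
qed

lemma bose_superadditive_double:
  assumes "\<alpha> \<ge> 1" "x > 0" "finite I" "finite J"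
    and "\<And>i j. i \<in> I \<Longrightarrow> j \<in> J \<Longrightarrow> a i j > 0"
  shows "(\<Sum>i\<in>I. \<Sum>j\<in>J. bose \<alpha> x (a i j)) \<le> bose \<alpha> x (\<Sum>i\<in>I. \<Sum>j\<in>J. a i j)"
  using bose_superadditive[of \<alpha> x "I \<times> J" "\<lambda>(i, j). a i j"] assms
  by (auto simp: sum.cartesian_product split_def)

theorem theorem4p2:
  fixes l m n :: nat
    and \<alpha> x :: real
    and lam :: "nat \<Rightarrow> nat \<Rightarrow> nat \<Rightarrow> real"
  assumes "l \<ge> 1" and "m \<ge> 1" and "n \<ge> 1"
    and "\<alpha> \<ge> 1" and "x > 0"
    and "\<And>i j k. i \<in> {1..l} \<Longrightarrow> j \<in> {1..m} \<Longrightarrow> k \<in> {1..n} \<Longrightarrow> lam i j k > 0"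
  shows
    "((\<Sum>k=1..n. \<Sum>j=1..m.
        (\<Sum>i=1..l. lam i j k) powr (\<alpha> - 1) / (exp (x / (\<Sum>i=1..l. lam i j k)) - 1))
     + (\<Sum>i=1..l. \<Sum>k=1..n.
        (\<Sum>j=1..m. lam i j k) powr (\<alpha> - 1) / (exp (x / (\<Sum>j=1..m. lam i j k)) - 1))
     + (\<Sum>j=1..m. \<Sum>i=1..l.
        (\<Sum>k=1..n. lam i j k) powr (\<alpha> - 1) / (exp (x / (\<Sum>k=1..n. lam i j k)) - 1))
     \<ge> 3 * (\<Sum>k=1..n. \<Sum>j=1..m. \<Sum>i=1..l.
        lam i j k powr (\<alpha> - 1) / (exp (x / lam i j k) - 1)))
    \<and>
    ((\<Sum>k=1..n.
        (\<Sum>j=1..m. \<Sum>i=1..l. lam i j k) powr (\<alpha> - 1)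
          / (exp (x / (\<Sum>j=1..m. \<Sum>i=1..l. lam i j k)) - 1))
     + (\<Sum>i=1..l.
        (\<Sum>k=1..n. \<Sum>j=1..m. lam i j k) powr (\<alpha> - 1)
          / (exp (x / (\<Sum>k=1..n. \<Sum>j=1..m. lam i j k)) - 1))
     + (\<Sum>j=1..m.
        (\<Sum>i=1..l. \<Sum>k=1..n. lam i j k) powr (\<alpha> - 1)
          / (exp (x / (\<Sum>i=1..l. \<Sum>k=1..n. lam i j k)) - 1))
     \<ge> 3 * (\<Sum>k=1..n. \<Sum>j=1..m. \<Sum>i=1..l.
        lam i j k powr (\<alpha> - 1) / (exp (x / lam i j k) - 1)))"
proof -
  note pos = assms(6)
  \<comment> \<open>\<open>T\<close> is written in three cyclic orders of summation, so that the
    indices to be moved inside \<open>bose\<close> are innermost: the last one for the first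
    inequality, the last two for the second.\<close>
  define T where "T = (\<Sum>k=1..n. \<Sum>j=1..m. \<Sum>i=1..l. bose \<alpha> x (lam i j k))"
  have T_ik: "T = (\<Sum>i=1..l. \<Sum>k=1..n. \<Sum>j=1..m. bose \<alpha> x (lam i j k))"
  proof -
    have "T = (\<Sum>k=1..n. \<Sum>i=1..l. \<Sum>j=1..m. bose \<alpha> x (lam i j k))"
      unfolding T_def by (intro sum.cong refl sum.swap)
    also have "\<dots> = (\<Sum>i=1..l. \<Sum>k=1..n. \<Sum>j=1..m. bose \<alpha> x (lam i j k))"
      by (rule sum.swap)
    finally show ?thesis .
  qed
  have T_ji: "T = (\<Sum>j=1..m. \<Sum>i=1..l. \<Sum>k=1..n. bose \<alpha> x (lam i j k))"
  proof -
    have "T = (\<Sum>i=1..l. \<Sum>j=1..m. \<Sum>k=1..n. bose \<alpha> x (lam i j k))"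
      unfolding T_ik by (intro sum.cong refl sum.swap)
    also have "\<dots> = (\<Sum>j=1..m. \<Sum>i=1..l. \<Sum>k=1..n. bose \<alpha> x (lam i j k))"
      by (rule sum.swap)
    finally show ?thesis .
  qed
  have "T \<le> (\<Sum>k=1..n. \<Sum>j=1..m. bose \<alpha> x (\<Sum>i=1..l. lam i j k))"
    unfolding T_def using assms by (intro sum_mono bose_superadditive pos) auto
  moreover have "T \<le> (\<Sum>i=1..l. \<Sum>k=1..n. bose \<alpha> x (\<Sum>j=1..m. lam i j k))"
    unfolding T_ik using assms by (intro sum_mono bose_superadditive pos) auto
  moreover have "T \<le> (\<Sum>j=1..m. \<Sum>i=1..l. bose \<alpha> x (\<Sum>k=1..n. lam i j k))"
    unfolding T_ji using assms by (intro sum_mono bose_superadditive pos) auto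
  moreover have "T \<le> (\<Sum>k=1..n. bose \<alpha> x (\<Sum>j=1..m. \<Sum>i=1..l. lam i j k))"
    unfolding T_def using assms by (intro sum_mono bose_superadditive_double pos) auto
  moreover have "T \<le> (\<Sum>i=1..l. bose \<alpha> x (\<Sum>k=1..n. \<Sum>j=1..m. lam i j k))"
    unfolding T_ik using assms by (intro sum_mono bose_superadditive_double pos) auto
  moreover have "T \<le> (\<Sum>j=1..m. bose \<alpha> x (\<Sum>i=1..l. \<Sum>k=1..n. lam i j k))"
    unfolding T_ji using assms by (intro sum_mono bose_superadditive_double pos) auto
  \<comment> \<open>Each conjunct is the sum of three of the six bounds on \<open>T\<close>.\<close>
  ultimately show ?thesis
    unfolding T_def bose_def by linarith
qed

end
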